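(* Let $p$ and $q$ be integers, and let $$r = \frac{p}{2} + \frac{\sqrt{p^2+4q}}{2}, \qquad s = \frac{p}{2} - \frac{\sqrt{p^2+4q}}{2}$$ be the two complex roots (with multiplicity) of the quadratic equation $z^2 - pz - q = 0$. Then $r^n + s^n$ is an integer for every natural number $n$.
   Context: If $p^2+4q<0$, then $\sqrt{p^2+4q}$ denotes a complex square root; the choice of square root does not matter, since it only interchanges $r$ and $s$. *)

theory Defs
  imports Complex_Main
begin

text \<open>
  A complex square root of \<open>p\<^sup>2 + 4 q\<close> is represented by an arbitrary complex number \<open>d\<close>
  with \<open>d\<^sup>2 = p\<^sup>2 + 4 q\<close>, so that both choices of the root are covered. The following lemma
  confirms that the resulting numbers are the roots, with multiplicity, of
  \<open>z\<^sup>2 - p z - q\<close>.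
\<close>

lemma quadratic_roots_factorization:
  fixes p q :: int and d r s z :: complex
  assumes "d\<^sup>2 = of_int (p\<^sup>2 + 4 * q)"
    and "r = of_int p / 2 + d / 2"
    and "s = of_int p / 2 - d / 2"
  shows "z\<^sup>2 - of_int p * z - of_int q = (z - r) * (z - s)"
proof -
  have "(z - r) * (z - s) = z\<^sup>2 - of_int p * z + ((of_int p)\<^sup>2 - d\<^sup>2) / 4"
    unfolding assms(2,3) by (simp add: field_simps power2_eq_square)
  then show ?thesis
    by (simp add: assms(1))
qed

end

theory Submission imports Defs begin

text \<open>
  The power sums satisfy the integer recurrence
  \<open>r\<^sup>n\<^sup>+\<^sup>2 + s\<^sup>n\<^sup>+\<^sup>2 = (r + s) (r\<^sup>n\<^sup>+\<^sup>1 + s\<^sup>n\<^sup>+\<^sup>1) - r s (r\<^sup>n + s\<^sup>n)\<close> with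
  \<open>r + s = p\<close> and \<open>r s = -q\<close>.
\<close>

lemma power_sum_in_Ints:
  fixes r s :: "'a::comm_ring_1"
  assumes "r + s \<in> \<int>" and "r * s \<in> \<int>"
  shows "r ^ n + s ^ n \<in> \<int>"
\<comment> \<open>The recurrence reaches back two indices, so the step needs the claim for both
  \<open>n\<close> and \<open>Suc n\<close>.\<close>
proof (induction n rule: induct_nat_012)
  case 0
  show ?case by simp
next
  case 1
  show ?case using assms(1) by simp
next
  case (ge2 n)
  \<comment> \<open>The cross terms \<open>r * s ^ Suc n + s * r ^ Suc n\<close> of the product are
    exactly what is subtracted.\<close>
  have "r ^ Suc (Suc n) + s ^ Suc (Suc n)
      = (r + s) * (r ^ Suc n + s ^ Suc n) - r * s * (r ^ n + s ^ n)"
    by (simp add: algebra_simps)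
  then show ?case
    using assms ge2 by (metis Ints_diff Ints_mult)
qed

theorem theorem1:
  fixes p q :: int and d r s :: complex and n :: nat
  assumes "d\<^sup>2 = of_int (p\<^sup>2 + 4 * q)"
    and "r = of_int p / 2 + d / 2"
    and "s = of_int p / 2 - d / 2"
  shows "r ^ n + s ^ n \<in> \<int>"
proof (rule power_sum_in_Ints)
  have "r + s = of_int p"
    by (simp add: assms(2,3))
  then show "r + s \<in> \<int>" by simp
  \<comment> \<open>At \<open>z = 0\<close> the factorization reads
    \<open>- q = (- r) * (- s)\<close>, which gives the product of the roots without expanding the
    square of \<open>d\<close> again.\<close>
  have "r * s = of_int (- q)"
    using quadratic_roots_factorization[OF assms, of 0] by simp
  then show "r * s \<in> \<int>" by (metis Ints_of_int)
qed

end
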